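(* Let $H$ be a nontrivial connected graph with $diam(H)\geq2$. (1) If $H$ is nonbipartite, then $spvc(K_2\times H)=2$. (2) Let $n\geq4$. If $diam(H)=2$ and every edge of $H$ is contained in a triangle of $H$, then $spvc(K_n\times H)=1$; otherwise $spvc(K_n\times H)=2$. (3) If $diam(H)=2$ and every edge of $H$ is contained in a triangle of $H$, then $spvc(K_3\times H)=1$; otherwise $spvc(K_3\times H)=2$ when $H$ is a tree, and $2\leq spvc(K_3\times H)\leq3$ when $H$ is not a tree.
   Context: All graphs are simple, finite and undirected; nontrivial means having at least two vertices; $K_n$ is the complete graph on $n$ vertices. The direct product $G\times H$ has vertex set $V(G)\times V(H)$, with $(g,h)$ adjacent to $(g',h')$ iff $gg'\in E(G)$ and $hh'\in E(H)$. In a vertex-colored graph, a path is vertex-proper if any two adjacent internal vertices of the path receive different colors. A $u$-$v$ geodesic is a $u$-$v$ path of length $d(u,v)$; $spvc(G)$ is the smallest number of colors in a vertex-coloring of a connected graph $G$ such that any two vertices $u,v$ are joined by a vertex-proper $u$-$v$ geodesic, with $spvc(G)=0$ for complete $G$. *)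

theory Defs
  imports "Graph_Theory.Graph_Theory" "HOL-Library.Extended_Nat"
begin

text \<open>
  A finite simple undirected graph is a \<open>pair_graph\<close>, i.e. a finite, loop-free, symmetric
  digraph without parallel arcs; an undirected edge \<open>uv\<close> is the pair of arcs \<open>(u, v)\<close>, \<open>(v, u)\<close>.
\<close>

definition direct_product ::
    "'a pair_pre_digraph \<Rightarrow> 'b pair_pre_digraph \<Rightarrow> ('a \<times> 'b) pair_pre_digraph" where
  "direct_product G H =
    \<lparr> pverts = pverts G \<times> pverts H,
      parcs = {((g, h), (g', h')) | g h g' h'. (g, g') \<in> parcs G \<and> (h, h') \<in> parcs H} \<rparr>"

lemma pair_graph_direct_product:
  assumes "pair_graph G" and "pair_graph H"
  shows "pair_graph (direct_product G H)"
proof -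
  interpret G: pair_graph G by fact
  interpret H: pair_graph H by fact
  have wf: "parcs (direct_product G H) \<subseteq>
      pverts (direct_product G H) \<times> pverts (direct_product G H)"
    by (auto simp: direct_product_def dest: G.wellformed' H.wellformed')
  have fin: "finite (pverts (direct_product G H))"
    by (simp add: direct_product_def G.pair_finite_verts H.pair_finite_verts)
  have "finite (parcs (direct_product G H))"
    by (rule finite_subset[OF wf]) (simp add: fin)
  moreover have "symmetric (with_proj (direct_product G H))"
    using G.pair_sym_arcs H.pair_sym_arcs
    by (auto simp: symmetric_def sym_def direct_product_def)
  moreover have "fst e \<noteq> snd e" if "e \<in> parcs (direct_product G H)" for e
    using that by (auto simp: direct_product_def dest: G.pair_no_loops)
  ultimately show ?thesis
    using wf fin by unfold_locales auto
qed

definition bipartite :: "'a pair_pre_digraph \<Rightarrow> bool" where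
  "bipartite G \<longleftrightarrow>
    (\<exists>U V. U \<union> V = pverts G \<and> U \<inter> V = {} \<and> parcs G \<subseteq> U \<times> V \<union> V \<times> U)"

text \<open>
  The library's \<open>forest\<close> and \<open>tree\<close> count \<open>u \<rightarrow> v \<rightarrow> u\<close> as a cycle, so no symmetric
  digraph with an arc satisfies them. Here a cycle has at least three vertices.
\<close>

definition has_cycle :: "'a pair_pre_digraph \<Rightarrow> bool" where
  "has_cycle G \<longleftrightarrow>
    (\<exists>p. vpath p (with_proj G) \<and> 3 \<le> length p \<and> (last p, hd p) \<in> parcs G)"

definition is_tree :: "'a pair_pre_digraph \<Rightarrow> bool" where
  "is_tree G \<longleftrightarrow> Digraph_Component.connected (with_proj G) \<and> \<not> has_cycle G"

text \<open>The arcs are loop-free, so the third vertex \<open>w\<close> differs from \<open>u\<close> and \<open>v\<close>.\<close>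

definition every_edge_in_triangle :: "'a pair_pre_digraph \<Rightarrow> bool" where
  "every_edge_in_triangle G \<longleftrightarrow>
    (\<forall>(u, v) \<in> parcs G. \<exists>w. (u, w) \<in> parcs G \<and> (v, w) \<in> parcs G)"

definition path_between :: "'a pair_pre_digraph \<Rightarrow> 'a \<Rightarrow> 'a list \<Rightarrow> 'a \<Rightarrow> bool" where
  "path_between G u p v \<longleftrightarrow> vpath p (with_proj G) \<and> hd p = u \<and> last p = v"

text \<open>The value is \<open>\<infinity>\<close> if there is no path.\<close>

definition graph_dist :: "'a pair_pre_digraph \<Rightarrow> 'a \<Rightarrow> 'a \<Rightarrow> enat" where
  "graph_dist G u v = (INF p \<in> {p. path_between G u p v}. enat (vwalk_length p))"

definition diam :: "'a pair_pre_digraph \<Rightarrow> enat" where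
  "diam G = (SUP u \<in> pverts G. SUP v \<in> pverts G. graph_dist G u v)"

definition geodesic :: "'a pair_pre_digraph \<Rightarrow> 'a \<Rightarrow> 'a list \<Rightarrow> 'a \<Rightarrow> bool" where
  "geodesic G u p v \<longleftrightarrow>
    path_between G u p v \<and> enat (vwalk_length p) = graph_dist G u v"

text \<open>
  \<open>butlast (tl p)\<close> lists the internal vertices of \<open>p\<close>; adjacency is adjacency along the path.
\<close>

definition vertex_proper :: "('a \<Rightarrow> nat) \<Rightarrow> 'a list \<Rightarrow> bool" where
  "vertex_proper c p \<longleftrightarrow> successively (\<lambda>x y. c x \<noteq> c y) (butlast (tl p))"

definition strong_proper_vertex_coloring :: "'a pair_pre_digraph \<Rightarrow> ('a \<Rightarrow> nat) \<Rightarrow> bool" where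
  "strong_proper_vertex_coloring G c \<longleftrightarrow>
    (\<forall>u \<in> pverts G. \<forall>v \<in> pverts G. \<exists>p. geodesic G u p v \<and> vertex_proper c p)"

text \<open>
  Meaningful for connected graphs only: otherwise no colouring qualifies and \<open>LEAST\<close> is unspecified.
\<close>

definition spvc :: "'a pair_pre_digraph \<Rightarrow> nat" where
  "spvc G =
    (if \<exists>n. complete_digraph n (with_proj G) then 0
     else (LEAST k. \<exists>c. strong_proper_vertex_coloring G c \<and> card (c ` pverts G) = k))"

end

theory Submission
  imports Defs
begin

text \<open>
  A walk in \<open>K \<times> H\<close> is a pair of walks of equal length, one in each factor, and a shortest walk is a
  geodesic. Two vertices at distance at least three force two colours, since a single colour only
  serves geodesics with at most one internal vertex. Conversely, a proper colouring makes every
  geodesic vertex-proper; the projection to \<open>K\<close> or a bipartition of \<open>H\<close> provides one. For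
  \<open>K = K\<^sub>n\<close> with \<open>n \<ge> 4\<close>, a geodesic of length at least three may be changed freely in its \<open>K\<close>-coordinate
  as long as consecutive entries differ. Splitting \<open>K\<close> into two classes of size at least two, the
  internal entries can be made to alternate between the classes while avoiding the end entries.
\<close>

section \<open>Walks and geodesics\<close>

lemma relpow_segment:
  assumes "\<And>i. i < L \<Longrightarrow> (f i, f (Suc i)) \<in> R" "i \<le> j" "j \<le> L"
  shows "(f i, f j) \<in> R ^^ (j - i)"
  unfolding relpow_fun_conv
  using assms by (intro exI[of _ "\<lambda>k. f (i + k)"]) auto

lemma relpow_sym:
  assumes "sym R" "(u, v) \<in> R ^^ n"
  shows "(v, u) \<in> R ^^ n"
  using assms(2)
proof (induction n arbitrary: v)
  case 0
  then show ?case by simp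
next
  case (Suc n)
  then obtain w where "(u, w) \<in> R ^^ n" "(w, v) \<in> R" by auto
  then show ?case using Suc.IH assms(1) by (blast intro: relpow_Suc_I2 dest: symD)
qed

lemma relpow_trans: "(u, v) \<in> R ^^ m \<Longrightarrow> (v, w) \<in> R ^^ n \<Longrightarrow> (u, w) \<in> R ^^ (m + n)"
  by (auto simp: relpow_add)

lemma relpow_2_iff: "(u, v) \<in> R ^^ 2 \<longleftrightarrow> (\<exists>w. (u, w) \<in> R \<and> (w, v) \<in> R)"
  by (auto simp: numeral_2_eq_2)

lemma le_two_cases: "m \<le> (2 :: nat) \<Longrightarrow> m = 0 \<or> m = 1 \<or> m = 2"
  by linarith

lemma set_vwalk_arcs_subset_iff:
  "set (vwalk_arcs p) \<subseteq> R \<longleftrightarrow> successively (\<lambda>x y. (x, y) \<in> R) p"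
  by (induction p rule: vwalk_arcs.induct) auto

text \<open>Distances are handled through relational powers, which allow repeated vertices. This
  matters because the coordinates of a path in a product are walks that need not be paths.\<close>

lemma path_between_relpow:
  assumes "path_between G u p v"
  shows "(u, v) \<in> parcs G ^^ vwalk_length p"
proof -
  have p: "p \<noteq> []" "successively (\<lambda>x y. (x, y) \<in> parcs G) p" "hd p = u" "last p = v"
    using assms by (simp_all add: path_between_def vpath_def vwalk_def set_vwalk_arcs_subset_iff)
  have "(p ! i, p ! Suc i) \<in> parcs G" if "i < vwalk_length p" for i
    using successively_nth[OF p(2)] that by simp
  moreover have "p ! 0 = u" "p ! vwalk_length p = v"
    using p by (simp_all add: hd_conv_nth last_conv_nth)
  ultimately show ?thesis unfolding relpow_fun_conv by blast
qed

lemma successively_map_upt: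
  "successively P (map f [m..<n]) \<longleftrightarrow> (\<forall>i. m \<le> i \<and> Suc i < n \<longrightarrow> P (f i) (f (Suc i)))"
proof -
  have "(\<forall>i. m \<le> i \<and> Suc i < n \<longrightarrow> P (f i) (f (Suc i))) \<longleftrightarrow>
      (\<forall>k. Suc k < n - m \<longrightarrow> P (f (m + k)) (f (Suc (m + k))))" (is "?L \<longleftrightarrow> ?R")
  proof
    show "?R" if ?L using that by (simp add: less_diff_conv add.commute)
    show "?L" if R: ?R
    proof (intro allI impI)
      fix i assume "m \<le> i \<and> Suc i < n"
      then show "P (f i) (f (Suc i))" using R[rule_format, of "i - m"] by auto
    qed
  qed
  then show ?thesis by (simp add: successively_conv_nth)
qed

text \<open>The internal vertices are \<open>f 1\<close> up to \<open>f (L - 1)\<close>, whence the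
  index range. For \<open>L \<le> 2\<close> the range is empty and every colouring is proper on the
  path.\<close>

lemma vertex_proper_map_upt:
  "vertex_proper c (map f [0..<Suc L]) \<longleftrightarrow>
    (\<forall>i. 0 < i \<and> Suc i < L \<longrightarrow> c (f i) \<noteq> c (f (Suc i)))"
proof -
  have "butlast (tl (map f [0..<Suc L])) = map f [1..<L]"
    by (cases L) (simp_all add: map_tl[symmetric] map_butlast[symmetric] del: upt_Suc, simp_all)
  then show ?thesis by (auto simp: vertex_proper_def successively_map_upt Suc_le_eq)
qed

lemma shortest_walk_path_between:
  assumes wf: "parcs G \<subseteq> pverts G \<times> pverts G" and "f 0 \<in> pverts G"
    and step: "\<And>i. i < L \<Longrightarrow> (f i, f (Suc i)) \<in> parcs G"
    and minimal: "\<And>m. m < L \<Longrightarrow> (f 0, f L) \<notin> parcs G ^^ m"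
  shows "path_between G (f 0) (map f [0..<Suc L]) (f L)"
proof -
  \<comment> \<open>If \<open>f i = f j\<close>, cutting out the closed part between them leaves a
    walk of length \<open>i + (L - j) < L\<close>, against minimality.\<close>
  have inj: "f i \<noteq> f j" if "i < j" "j \<le> L" for i j
  proof
    assume "f i = f j"
    moreover have "(f 0, f i) \<in> parcs G ^^ (i - 0)" "(f j, f L) \<in> parcs G ^^ (L - j)"
      using that by (intro relpow_segment[where L = L] step; simp)+
    ultimately have "(f 0, f L) \<in> parcs G ^^ (i - 0 + (L - j))"
      by (simp only: relpow_trans)
    then show False using minimal that by auto
  qed
  have "inj_on f {0..<Suc L}"
    by (rule inj_onI) (metis inj atLeastLessThan_iff less_Suc_eq_le linorder_neqE_nat)
  then have "distinct (map f [0..<Suc L])"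
    by (simp only: distinct_map distinct_upt set_upt simp_thms)
  moreover have "f i \<in> pverts G" if "i \<le> L" for i
    using that wf step[of "i - 1"] \<open>f 0 \<in> pverts G\<close> by (cases i) auto
  then have "set (map f [0..<Suc L]) \<subseteq> pverts G"
    by (auto simp del: upt_Suc)
  moreover have "successively (\<lambda>x y. (x, y) \<in> parcs G) (map f [0..<Suc L])"
    unfolding successively_map_upt using step by simp
  moreover have "hd (map f [0..<Suc L]) = f 0" "last (map f [0..<Suc L]) = f L"
    by (simp_all add: hd_map del: upt_Suc, simp_all)
  ultimately show ?thesis
    by (simp add: path_between_def vpath_def vwalk_def set_vwalk_arcs_subset_iff del: upt_Suc)
qed

text \<open>Every path is a walk of its own length, so minimality among all walks bounds the infimum
  over paths from below.\<close>

lemma shortest_walk_geodesic: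
  assumes "parcs G \<subseteq> pverts G \<times> pverts G" "f 0 \<in> pverts G"
    and "\<And>i. i < L \<Longrightarrow> (f i, f (Suc i)) \<in> parcs G"
    and minimal: "\<And>m. m < L \<Longrightarrow> (f 0, f L) \<notin> parcs G ^^ m"
  shows "geodesic G (f 0) (map f [0..<Suc L]) (f L)"
proof -
  let ?p = "map f [0..<Suc L]"
  have path: "path_between G (f 0) ?p (f L)"
    by (rule shortest_walk_path_between) (use assms in auto)
  have len: "vwalk_length ?p = L" by simp
  have "graph_dist G (f 0) (f L) \<le> enat (vwalk_length ?p)"
    unfolding graph_dist_def by (rule INF_lower) (use path in simp)
  moreover have "enat (vwalk_length ?p) \<le> graph_dist G (f 0) (f L)"
    unfolding graph_dist_def
  proof (rule INF_greatest)
    fix q assume "q \<in> {p. path_between G (f 0) p (f L)}"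
    then have "path_between G (f 0) q (f L)" by simp
    then have "(f 0, f L) \<in> parcs G ^^ vwalk_length q" by (rule path_between_relpow)
    then have "\<not> vwalk_length q < L" using minimal by blast
    then show "enat (vwalk_length ?p) \<le> enat (vwalk_length q)" unfolding len by simp
  qed
  ultimately show ?thesis using path unfolding geodesic_def by (auto intro: antisym)
qed

lemma shortest_walk:
  assumes "(u, v) \<in> R ^^ n"
  obtains L f where "L \<le> n" "f 0 = u" "f L = v" "\<forall>i<L. (f i, f (Suc i)) \<in> R"
    "\<forall>m<L. (u, v) \<notin> R ^^ m"
proof -
  let ?L = "LEAST n. (u, v) \<in> R ^^ n"
  have "(u, v) \<in> R ^^ ?L" using assms by (rule LeastI)
  then obtain f where "f 0 = u" "f ?L = v" "\<And>i. i < ?L \<Longrightarrow> (f i, f (Suc i)) \<in> R"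
    unfolding relpow_fun_conv by blast
  moreover have "?L \<le> n" using assms by (rule Least_le)
  ultimately show thesis using that not_less_Least by blast
qed

lemma graph_dist_le_iff:
  assumes wf: "parcs G \<subseteq> pverts G \<times> pverts G" and u: "u \<in> pverts G"
  shows "graph_dist G u v \<le> enat k \<longleftrightarrow> (\<exists>m\<le>k. (u, v) \<in> parcs G ^^ m)"
proof
  let ?A = "(\<lambda>p. enat (vwalk_length p)) ` {p. path_between G u p v}"
  assume le: "graph_dist G u v \<le> enat k"
  \<comment> \<open>An empty infimum is \<open>\<infinity>\<close>, which lies above every
    \<open>enat k\<close>. For a nonempty set of \<open>enat\<close> the infimum is attained, so
    some path realises the distance.\<close>
  have "?A \<noteq> {}"
  proof
    assume "?A = {}"
    then have "graph_dist G u v = \<infinity>" by (simp add: graph_dist_def Inf_enat_def)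
    then show False using le by simp
  qed
  then have "Inf ?A \<in> ?A" unfolding Inf_enat_def by (metis (mono_tags, lifting) LeastI ex_in_conv)
  then obtain p where "path_between G u p v" "graph_dist G u v = enat (vwalk_length p)"
    unfolding graph_dist_def by auto
  then show "\<exists>m\<le>k. (u, v) \<in> parcs G ^^ m"
    using le path_between_relpow by (metis enat_ord_simps(1))
next
  assume "\<exists>m\<le>k. (u, v) \<in> parcs G ^^ m"
  then obtain m where "m \<le> k" and "(u, v) \<in> parcs G ^^ m" by blast
  from this(2) obtain L f where L: "L \<le> m" and f: "f 0 = u" "f L = v"
    "\<forall>i<L. (f i, f (Suc i)) \<in> parcs G" "\<forall>m<L. (u, v) \<notin> parcs G ^^ m"
    by (rule shortest_walk)
  have "geodesic G (f 0) (map f [0..<Suc L]) (f L)"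
    by (rule shortest_walk_geodesic) (use wf u f in auto)
  then have "graph_dist G u v = enat L" by (simp add: geodesic_def f)
  then show "graph_dist G u v \<le> enat k" using L \<open>m \<le> k\<close> by simp
qed

lemma diam_le_iff:
  assumes "parcs G \<subseteq> pverts G \<times> pverts G"
  shows "diam G \<le> enat k \<longleftrightarrow>
    (\<forall>u\<in>pverts G. \<forall>v\<in>pverts G. \<exists>m\<le>k. (u, v) \<in> parcs G ^^ m)"
  using graph_dist_le_iff[OF assms] by (simp add: diam_def SUP_le_iff)

text \<open>\<open>connected\<close> refers to the symmetric closure of the digraph; the arcs are
  symmetric already, so that closure has the same arcs.\<close>

lemma connected_relpow:
  assumes "pair_graph G" "Digraph_Component.connected (with_proj G)"
    "u \<in> pverts G" "v \<in> pverts G"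
  shows "\<exists>n. (u, v) \<in> parcs G ^^ n"
proof -
  interpret pair_graph G by fact
  have "(snd e, fst e) \<in> parcs G" if "e \<in> parcs G" for e
    using that arcs_symmetric[of "fst e" "snd e"] by simp
  then have "parcs (mk_symmetric (with_proj G)) = parcs G"
    by (auto simp: mk_symmetric_def)
  moreover have "reachable (with_proj (mk_symmetric (with_proj G))) u v"
    using assms(2-4)
    unfolding Digraph_Component.connected_def strongly_connected_def
    by (simp add: mk_symmetric_def)
  ultimately have "(u, v) \<in> (parcs G)\<^sup>*"
    using reachable_rtranclI with_proj_simps(3) by metis
  then show ?thesis by (rule rtrancl_imp_relpow)
qed

section \<open>Strong proper colourings\<close>

lemma strong_proper_vertex_coloringI:
  assumes "parcs G \<subseteq> pverts G \<times> pverts G"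
    and "\<And>u v. u \<in> pverts G \<Longrightarrow> v \<in> pverts G \<Longrightarrow>
      \<exists>f L. f 0 = u \<and> f L = v \<and> (\<forall>i<L. (f i, f (Suc i)) \<in> parcs G) \<and>
        (\<forall>m<L. (u, v) \<notin> parcs G ^^ m) \<and>
        (\<forall>i. 0 < i \<and> Suc i < L \<longrightarrow> c (f i) \<noteq> c (f (Suc i)))"
  shows "strong_proper_vertex_coloring G c"
  unfolding strong_proper_vertex_coloring_def
proof (intro ballI)
  fix u v assume uv: "u \<in> pverts G" "v \<in> pverts G"
  then obtain f L where f: "f 0 = u" "f L = v" "\<forall>i<L. (f i, f (Suc i)) \<in> parcs G"
    "\<forall>m<L. (u, v) \<notin> parcs G ^^ m" "\<forall>i. 0 < i \<and> Suc i < L \<longrightarrow> c (f i) \<noteq> c (f (Suc i))"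
    using assms(2)[OF uv] by blast
  have "geodesic G (f 0) (map f [0..<Suc L]) (f L)"
    by (rule shortest_walk_geodesic) (use assms(1) uv f in auto)
  then show "\<exists>p. geodesic G u p v \<and> vertex_proper c p"
    using f vertex_proper_map_upt by blast
qed

lemma proper_coloring_strong:
  assumes "parcs G \<subseteq> pverts G \<times> pverts G"
    and "\<And>u v. u \<in> pverts G \<Longrightarrow> v \<in> pverts G \<Longrightarrow> \<exists>n. (u, v) \<in> parcs G ^^ n"
    and proper: "\<And>x y. (x, y) \<in> parcs G \<Longrightarrow> c x \<noteq> c y"
  shows "strong_proper_vertex_coloring G c"
proof (rule strong_proper_vertex_coloringI[OF assms(1)])
  fix u v assume "u \<in> pverts G" "v \<in> pverts G"
  then obtain n where "(u, v) \<in> parcs G ^^ n" using assms(2) by blast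
  then obtain L f where "L \<le> n" and f: "f 0 = u" "f L = v"
    "\<forall>i<L. (f i, f (Suc i)) \<in> parcs G" "\<forall>m<L. (u, v) \<notin> parcs G ^^ m"
    by (rule shortest_walk)
  moreover have "\<forall>i. 0 < i \<and> Suc i < L \<longrightarrow> c (f i) \<noteq> c (f (Suc i))"
    using f(3) proper by simp
  ultimately show "\<exists>f L. f 0 = u \<and> f L = v \<and> (\<forall>i<L. (f i, f (Suc i)) \<in> parcs G) \<and>
        (\<forall>m<L. (u, v) \<notin> parcs G ^^ m) \<and>
        (\<forall>i. 0 < i \<and> Suc i < L \<longrightarrow> c (f i) \<noteq> c (f (Suc i)))" by blast
qed

lemma diam_le_two_strong:
  assumes "parcs G \<subseteq> pverts G \<times> pverts G" "diam G \<le> 2"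
  shows "strong_proper_vertex_coloring G c"
proof (rule strong_proper_vertex_coloringI[OF assms(1)])
  fix u v assume "u \<in> pverts G" "v \<in> pverts G"
  moreover have "\<forall>u\<in>pverts G. \<forall>v\<in>pverts G. \<exists>m\<le>2. (u, v) \<in> parcs G ^^ m"
    using assms diam_le_iff[of G 2] by (simp add: numeral_eq_enat)
  ultimately obtain n where "n \<le> 2" and "(u, v) \<in> parcs G ^^ n" by blast
  from this(2) obtain L f where f: "L \<le> n" "f 0 = u" "f L = v"
    "\<forall>i<L. (f i, f (Suc i)) \<in> parcs G" "\<forall>m<L. (u, v) \<notin> parcs G ^^ m"
    by (rule shortest_walk)
  moreover have "\<forall>i. 0 < i \<and> Suc i < L \<longrightarrow> c (f i) \<noteq> c (f (Suc i))"
    using f(1) \<open>n \<le> 2\<close> by auto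
  ultimately show "\<exists>f L. f 0 = u \<and> f L = v \<and> (\<forall>i<L. (f i, f (Suc i)) \<in> parcs G) \<and>
        (\<forall>m<L. (u, v) \<notin> parcs G ^^ m) \<and>
        (\<forall>i. 0 < i \<and> Suc i < L \<longrightarrow> c (f i) \<noteq> c (f (Suc i)))" by blast
qed

lemma spvc_le:
  assumes "strong_proper_vertex_coloring G c" "card (c ` pverts G) \<le> k"
  shows "spvc G \<le> k"
proof (cases "\<exists>n. complete_digraph n (with_proj G)")
  case False
  have "(LEAST k. \<exists>c. strong_proper_vertex_coloring G c \<and> card (c ` pverts G) = k)
      \<le> card (c ` pverts G)"
    using assms(1) by (intro Least_le) blast
  then show ?thesis using False assms(2) by (simp add: spvc_def)
qed (simp add: spvc_def)

text \<open>Two distinct nonadjacent vertices exclude the complete case, and the given colouring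
  shows that the \<open>LEAST\<close> is taken over a nonempty set. Lower bounds can then be proved
  on an optimal colouring.\<close>

lemma spvc_attained:
  assumes "strong_proper_vertex_coloring G c"
    and "u \<in> pverts G" "v \<in> pverts G" "u \<noteq> v" "(u, v) \<notin> parcs G"
  obtains c' where "strong_proper_vertex_coloring G c'" "card (c' ` pverts G) = spvc G"
proof -
  let ?P = "\<lambda>k. \<exists>c. strong_proper_vertex_coloring G c \<and> card (c ` pverts G) = k"
  have "\<not> (\<exists>n. complete_digraph n (with_proj G))"
    using assms(2-) by (auto simp: complete_digraph_pair_def)
  then have "spvc G = (LEAST k. ?P k)" by (simp add: spvc_def)
  moreover have "?P (card (c ` pverts G))" using assms(1) by blast
  then have "?P (LEAST k. ?P k)" by (rule LeastI)
  ultimately show thesis using that by metis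
qed

lemma spvc_pos:
  assumes "finite (pverts G)" "strong_proper_vertex_coloring G c"
    and "u \<in> pverts G" "v \<in> pverts G" "u \<noteq> v" "(u, v) \<notin> parcs G"
  shows "1 \<le> spvc G"
proof -
  obtain c' :: "_ \<Rightarrow> nat" where "card (c' ` pverts G) = spvc G"
    using assms(2-) by (blast elim: spvc_attained)
  then show ?thesis using assms(1,3)
    by (metis One_nat_def Suc_leI card_gt_0_iff empty_iff finite_imageI image_is_empty)
qed

text \<open>A geodesic between vertices at distance at least three has two consecutive internal
  vertices, and these need distinct colours in any optimal colouring.\<close>

lemma spvc_ge_two:
  assumes "finite (pverts G)" "strong_proper_vertex_coloring G c"
    and uv: "u \<in> pverts G" "v \<in> pverts G" and far: "\<And>m. m \<le> 2 \<Longrightarrow> (u, v) \<notin> parcs G ^^ m"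
  shows "2 \<le> spvc G"
proof -
  have "u \<noteq> v" "(u, v) \<notin> parcs G" using far[of 0] far[of 1] by auto
  then obtain c' where c': "strong_proper_vertex_coloring G c'" "card (c' ` pverts G) = spvc G"
    using assms(2) uv by (blast elim: spvc_attained)
  obtain p where p: "geodesic G u p v" "vertex_proper c' p"
    using c'(1) uv by (auto simp: strong_proper_vertex_coloring_def)
  have "path_between G u p v" using p(1) by (simp add: geodesic_def)
  then have "(u, v) \<in> parcs G ^^ vwalk_length p" "set p \<subseteq> pverts G"
    by (auto simp only: path_between_relpow) (auto simp: path_between_def vpath_def vwalk_def)
  then have "\<not> vwalk_length p \<le> 2" using far by blast
  then have "4 \<le> length p" by simp
  \<comment> \<open>Because of \<open>z\<close>, both \<open>x\<close> and \<open>y\<close> are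
    internal whatever \<open>r\<close> is.\<close>
  then obtain w x y z r where p_eq: "p = w # x # y # z # r"
    by (metis (no_types, opaque_lifting) Suc_le_length_iff numeral_eq_Suc pred_numeral_simps(2)
        pred_numeral_simps(3) BitM.simps(1) BitM.simps(2) )
  have "c' x \<noteq> c' y" using p(2) by (simp add: vertex_proper_def p_eq split: if_splits)
  moreover have "{c' x, c' y} \<subseteq> c' ` pverts G" using \<open>set p \<subseteq> pverts G\<close> by (auto simp: p_eq)
  ultimately show ?thesis
    using card_mono[of "c' ` pverts G" "{c' x, c' y}"] assms(1) c'(2) by simp
qed

section \<open>Bipartite graphs and odd closed walks\<close>

text \<open>The vertices reachable from \<open>u\<close> in an even and in an odd number of steps
  cover the graph, and each arc joins one set to the other. Were they disjoint, they would be a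
  bipartition; so some \<open>w\<close> is reached with both parities, which gives an odd closed
  walk at \<open>u\<close>.\<close>

lemma nonbipartite_relpow_parity:
  assumes G: "pair_graph G" "Digraph_Component.connected (with_proj G)" and "\<not> bipartite G"
    and uv: "u \<in> pverts G" "v \<in> pverts G"
  shows "\<exists>n. even n = b \<and> (u, v) \<in> parcs G ^^ n"
proof -
  interpret pair_graph G by fact
  have sym: "sym (parcs G)" using pair_sym_arcs by (simp add: symmetric_def)
  define S where "S = (\<lambda>b. {w \<in> pverts G. \<exists>n. even n = b \<and> (u, w) \<in> parcs G ^^ n})"
  have cover: "S True \<union> S False = pverts G"
    using connected_relpow[OF G uv(1)] by (auto simp: S_def)
  have step: "y \<in> S (\<not> b)" if xy: "(x, y) \<in> parcs G" and x: "x \<in> S b" for x y b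
  proof -
    obtain n where n: "even n = b" "(u, x) \<in> parcs G ^^ n" using x unfolding S_def by blast
    then have "(u, y) \<in> parcs G ^^ Suc n" using xy by auto
    moreover have "even (Suc n) = (\<not> b)" using n(1) by simp
    ultimately show ?thesis using in_arcsD2[OF xy] unfolding S_def by blast
  qed
  have "parcs G \<subseteq> S True \<times> S False \<union> S False \<times> S True"
  proof clarify
    fix x y assume xy: "(x, y) \<in> parcs G" "\<not> (x \<in> S False \<and> y \<in> S True)"
    have "x \<in> S True \<or> x \<in> S False" using in_arcsD1[OF xy(1)] cover by blast
    then show "x \<in> S True \<and> y \<in> S False"
      using step[OF xy(1), of True] step[OF xy(1), of False] xy(2) by auto
  qed
  then have "S True \<inter> S False \<noteq> {}"
    using \<open>\<not> bipartite G\<close> cover unfolding bipartite_def by blast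
  then obtain w m n where mn: "even m" "odd n" "(u, w) \<in> parcs G ^^ m" "(u, w) \<in> parcs G ^^ n"
    by (auto simp: S_def)
  obtain k where k: "(u, v) \<in> parcs G ^^ k" using connected_relpow[OF G uv] by blast
  \<comment> \<open>Go to \<open>w\<close> in \<open>m\<close> steps, return in \<open>n\<close>
    steps by symmetry, then continue to \<open>v\<close>. As \<open>m + n\<close> is odd, this
    detour flips the parity of \<open>k\<close>.\<close>
  have "(u, v) \<in> parcs G ^^ (m + n + k)"
    using mn k relpow_sym[OF sym] by (blast intro: relpow_trans)
  moreover have "even k = b \<or> even (m + n + k) = b" using mn by auto
  ultimately show ?thesis using k by blast
qed

text \<open>A repeated vertex splits an odd closed walk into two closed walks, one of them odd.\<close>

lemma odd_closed_walk_has_cycle: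
  assumes "\<And>x. (x, x) \<notin> parcs G"
    and "successively (\<lambda>x y. (x, y) \<in> parcs G) p" "odd (length p)" "set p \<subseteq> pverts G"
    and "(last p, hd p) \<in> parcs G"
  shows "has_cycle G"
  using assms(2-)
proof (induction "length p" arbitrary: p rule: less_induct)
  case less
  show ?case
  proof (cases "distinct p")
    case True
    have "length p \<noteq> 1"
    proof
      assume "length p = 1"
      then obtain x where "p = [x]" by (cases p) auto
      then show False using less.prems(4) assms(1) by simp
    qed
    then have "3 \<le> length p" using \<open>odd (length p)\<close> by presburger
    then show ?thesis
      using True less.prems unfolding has_cycle_def vpath_def vwalk_def
      by (auto simp: set_vwalk_arcs_subset_iff)
  next
    case False
    then obtain xs ys zs a where p: "p = xs @ [a] @ ys @ [a] @ zs"
      using not_distinct_decomp by blast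
    let ?E = "\<lambda>x y. (x, y) \<in> parcs G"
    have split: "successively ?E (xs @ a # ys)" "successively ?E (a # zs)" "?E (last (a # ys)) a"
      using less.prems(1) successively_append_iff[of ?E "xs @ a # ys" "a # zs"] by (simp_all add: p)
    have parts: "successively ?E xs" "successively ?E (a # ys)" "xs = [] \<or> ?E (last xs) a"
      using split(1) successively_append_iff[of ?E xs "a # ys"] by simp_all
    have "last (xs @ a # zs) = last p" "hd (xs @ a # zs) = hd p" by (cases xs; simp add: p)+
    then have closing: "?E (last (xs @ a # zs)) (hd (xs @ a # zs))" using less.prems(4) by metis
    \<comment> \<open>The lengths of \<open>a # ys\<close> and \<open>xs @ a # zs\<close> add up to
      the odd \<open>length p\<close>, so exactly one of these shorter closed walks is odd.\<close>
    show ?thesis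
    proof (cases "odd (length (a # ys))")
      case True
      then show ?thesis
        using less.hyps[of "a # ys"] less.prems(3) parts(2) split(3) by (simp add: p)
    next
      case False
      have "successively ?E (xs @ a # zs)"
        using parts split(2) successively_append_iff[of ?E xs "a # zs"] by simp
      then show ?thesis
        using less.prems(2,3) False closing by (intro less.hyps[of "xs @ a # zs"]) (simp_all add: p)
    qed
  qed
qed

text \<open>A connected nonbipartite graph has a closed walk of odd length, and hence a
  cycle.\<close>

lemma tree_bipartite:
  assumes "pair_graph G" "is_tree G"
  shows "bipartite G"
proof (rule ccontr)
  interpret pair_graph G by fact
  assume "\<not> bipartite G"
  have conn: "Digraph_Component.connected (with_proj G)" using assms(2) by (simp add: is_tree_def)
  then obtain u where u: "u \<in> pverts G"
    by (auto simp: Digraph_Component.connected_def strongly_connected_def mk_symmetric_def)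
  then obtain n f where "odd n" and f: "f 0 = u" "f n = u" "\<And>i. i < n \<Longrightarrow> (f i, f (Suc i)) \<in> parcs G"
    using nonbipartite_relpow_parity[OF assms(1) conn \<open>\<not> bipartite G\<close> u u, of False]
    unfolding relpow_fun_conv by blast
  then have "0 < n" by (auto intro: gr0I)
  have "has_cycle G"
  proof (rule odd_closed_walk_has_cycle)
    show "(x, x) \<notin> parcs G" for x using no_loops' by blast
    \<comment> \<open>Since \<open>f n = f 0\<close>, the list stops at \<open>f (n - 1)\<close>;
      the last step of the walk becomes the closing arc.\<close>
    show "successively (\<lambda>x y. (x, y) \<in> parcs G) (map f [0..<n])"
      unfolding successively_map_upt using f(3) by simp
    show "odd (length (map f [0..<n]))" using \<open>odd n\<close> by simp
    show "set (map f [0..<n]) \<subseteq> pverts G" using in_arcsD1[OF f(3)] by auto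
    show "(last (map f [0..<n]), hd (map f [0..<n])) \<in> parcs G"
      using f(1,2) f(3)[of "n - 1"] \<open>0 < n\<close> by (simp add: last_map hd_map)
  qed
  then show False using assms(2) by (simp add: is_tree_def)
qed

section \<open>Direct products with complete graphs\<close>

lemma direct_product_simps:
  "pverts (direct_product K H) = pverts K \<times> pverts H"
  "((g, h), (g', h')) \<in> parcs (direct_product K H) \<longleftrightarrow> (g, g') \<in> parcs K \<and> (h, h') \<in> parcs H"
  by (auto simp: direct_product_def)

lemma direct_product_relpow:
  "((g, h), (g', h')) \<in> parcs (direct_product K H) ^^ n \<longleftrightarrow>
    (g, g') \<in> parcs K ^^ n \<and> (h, h') \<in> parcs H ^^ n"
proof (induction n arbitrary: g' h')
  case (Suc n)
  then show ?case by (auto simp: relcomp_unfold direct_product_simps)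
qed auto

section \<open>Walks in complete graphs\<close>

lemma complete_parcs_iff:
  "complete_digraph n (with_proj K) \<Longrightarrow> (g, g') \<in> parcs K \<longleftrightarrow> g \<in> pverts K \<and> g' \<in> pverts K \<and> g \<noteq> g'"
  by (simp add: complete_digraph_pair_def)

lemma ex_avoiding:
  assumes "finite X" "finite Y" "card Y < card X"
  obtains x where "x \<in> X" "x \<notin> Y"
  using assms by (metis card_mono leD subsetI)

text \<open>With three vertices, any two, equal or not, have a common neighbour, and a walk can
  always be prolonged. Hence for lengths from two on, only \<open>H\<close> decides whether a walk
  in the product exists.\<close>

lemma complete_relpow:
  assumes K: "complete_digraph n (with_proj K)" and "3 \<le> n" "2 \<le> L"
    and "g \<in> pverts K" "g' \<in> pverts K"
  shows "(g, g') \<in> parcs K ^^ L"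
proof -
  have avoid: "\<exists>w\<in>pverts K. w \<noteq> x \<and> w \<noteq> y" for x y
  proof -
    have "card {x, y} \<le> 2" by (rule card_insert_le_m1) auto
    then show ?thesis
      using K \<open>3 \<le> n\<close> ex_avoiding[of "pverts K" "{x, y}"] by (auto simp: complete_digraph_pair_def)
  qed
  from \<open>2 \<le> L\<close> \<open>g' \<in> pverts K\<close> show ?thesis
  proof (induction L arbitrary: g' rule: dec_induct)
    case base
    then show ?case
      using avoid[of g g'] \<open>g \<in> pverts K\<close> by (auto simp: relpow_2_iff complete_parcs_iff[OF K])
  next
    case (step L)
    obtain w where "w \<in> pverts K" "w \<noteq> g'" using avoid by blast
    then have "(g, w) \<in> parcs K ^^ L" "(w, g') \<in> parcs K"
      using step by (simp_all add: complete_parcs_iff[OF K])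
    then show ?case by (rule relpow_Suc_I)
  qed
qed

text \<open>Stepping back and forth between \<open>g\<close> and \<open>w\<close> uses up any even
  number of steps; an odd length leaves one final step to \<open>g'\<close>. This serves
  \<open>K\<^sub>2\<close>, where no longer detours exist.\<close>

lemma complete_relpow_parity:
  assumes K: "complete_digraph n (with_proj K)" and g: "g \<in> pverts K" "g' \<in> pverts K" "w \<in> pverts K" "w \<noteq> g"
    and "even L \<longleftrightarrow> g = g'"
  shows "(g, g') \<in> parcs K ^^ L"
proof -
  have even: "(g, g) \<in> parcs K ^^ (2 * k)" for k
  proof (induction k)
    case (Suc k)
    moreover have "(g, g) \<in> parcs K ^^ 2"
      using g by (auto simp: relpow_2_iff complete_parcs_iff[OF K])
    ultimately show ?case using relpow_trans[of g g "2 * k" "parcs K" g 2] by (simp add: add.commute)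
  qed simp
  show ?thesis
  proof (cases "even L")
    case True
    then show ?thesis using even assms(6) by (auto elim: evenE)
  next
    case False
    then obtain k where "L = Suc (2 * k)" by (auto elim: oddE)
    moreover have "(g, g') \<in> parcs K" using False assms(6) g by (simp add: complete_parcs_iff[OF K])
    ultimately show ?thesis using even[of k] by (auto intro: relcompI)
  qed
qed

section \<open>Alternating geodesics in the product\<close>

lemma alternating_strong_coloring:
  assumes K: "complete_digraph n (with_proj K)"
    and wf: "parcs H \<subseteq> pverts H \<times> pverts H"
    and reach: "\<And>u v. u \<in> pverts K \<times> pverts H \<Longrightarrow> v \<in> pverts K \<times> pverts H \<Longrightarrow>
      \<exists>n. (u, v) \<in> parcs (direct_product K H) ^^ n"
    and ab: "a \<in> pverts K" "b \<in> pverts K" "a \<noteq> b"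
    and pq: "p \<in> pverts K" "q \<in> pverts K" "p \<noteq> q" "{a, b} \<inter> {p, q} = {}"
  shows "strong_proper_vertex_coloring (direct_product K H) (\<lambda>x. if fst x \<in> {a, b} then 0 else 1)"
    (is "strong_proper_vertex_coloring ?G ?c")
proof (rule strong_proper_vertex_coloringI)
  show "parcs ?G \<subseteq> pverts ?G \<times> pverts ?G"
    using wf K by (auto simp: direct_product_def complete_parcs_iff)
next
  fix u v assume uv: "u \<in> pverts ?G" "v \<in> pverts ?G"
  then obtain n where "(u, v) \<in> parcs ?G ^^ n"
    using reach[of u v] unfolding direct_product_simps by blast
  then obtain L f where "L \<le> n" and f: "f 0 = u" "f L = v"
    "\<forall>i<L. (f i, f (Suc i)) \<in> parcs ?G" "\<forall>m<L. (u, v) \<notin> parcs ?G ^^ m"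
    by (rule shortest_walk)
  show "\<exists>f L. f 0 = u \<and> f L = v \<and> (\<forall>i<L. (f i, f (Suc i)) \<in> parcs ?G) \<and>
        (\<forall>m<L. (u, v) \<notin> parcs ?G ^^ m) \<and>
        (\<forall>i. 0 < i \<and> Suc i < L \<longrightarrow> ?c (f i) \<noteq> ?c (f (Suc i)))"
  proof (cases "L \<le> 2")
    case True
    then show ?thesis using f by (intro exI[of _ f] exI[of _ L]) auto
  next
    case False
    \<comment> \<open>\<open>pick i x\<close> takes a vertex from \<open>{a, b}\<close> for odd
      \<open>i\<close> and from \<open>{p, q}\<close> for even \<open>i\<close>. Each class has two
      members, so \<open>x\<close> can be avoided.\<close>
    define pick where "pick = (\<lambda>(i :: nat) x. if odd i then (if x = a then b else a) else (if x = p then q else p))"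
    \<comment> \<open>Entry \<open>L - 1\<close> must avoid \<open>fst v\<close> and entry
      \<open>1\<close> must avoid \<open>fst u\<close>. Since \<open>L \<ge> 3\<close> these
      positions differ, so no entry has to avoid both ends. Other neighbouring internal entries
      differ by class.\<close>
    define k where "k = (\<lambda>i. if i = 0 then fst u else if i = L then fst v
      else if Suc i = L then pick i (fst v) else pick i (fst u))"
    have pick: "pick i x \<in> pverts K" "pick i x \<noteq> x" "pick i x \<in> {a, b} \<longleftrightarrow> odd i" for i x
      using ab pq by (auto simp: pick_def)
    have k_in: "k i \<in> pverts K" for i
      using uv pick(1) by (auto simp: k_def direct_product_simps)
    have k_class: "k i \<in> {a, b} \<longleftrightarrow> odd i" if "0 < i" "i < L" for i
      using that pick(3) by (simp add: k_def)
    have "k i \<noteq> k (Suc i)" if "i < L" for i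
    proof (cases "i = 0 \<or> Suc i = L")
      case True
      then show ?thesis using False pick(2) by (auto simp: k_def dest: sym)
    next
      case False
      then show ?thesis using k_class[of i] k_class[of "Suc i"] that by auto
    qed
    then have "(k i, k (Suc i)) \<in> parcs K" if "i < L" for i
      using that k_in by (simp add: complete_parcs_iff[OF K])
    moreover have "(snd (f i), snd (f (Suc i))) \<in> parcs H" if "i < L" for i
      using f(3) that by (fastforce simp: direct_product_def)
    moreover have "?c (k i, x) \<noteq> ?c (k (Suc i), y)" if "0 < i" "Suc i < L" for i x y
      using k_class[of i] k_class[of "Suc i"] that by auto
    \<comment> \<open>The new walk keeps the \<open>H\<close>-coordinate, the ends and the length
      \<open>L\<close>, so it is again shortest.\<close>
    ultimately show ?thesis
      using f False by (intro exI[of _ "\<lambda>i. (k i, snd (f i))"] exI[of _ L])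
        (auto simp: direct_product_simps k_def)
  qed
qed

lemma card_two_valued_le: "card ((\<lambda>x. if P x then a else b) ` A) \<le> 2"
proof -
  have "card ((\<lambda>x. if P x then a else b) ` A) \<le> card {a, b}" by (rule card_mono) auto
  also have "\<dots> \<le> 2" by (rule card_insert_le_m1) auto
  finally show ?thesis .
qed

section \<open>The product with \<open>K\<^sub>2\<close>\<close>

lemma spvc_K2_product:
  assumes H: "pair_graph H" "Digraph_Component.connected (with_proj H)" "\<not> bipartite H"
    and K: "complete_digraph 2 (with_proj K)"
  shows "spvc (direct_product K H) = 2"
proof -
  interpret pair_graph H by fact
  let ?G = "direct_product K H"
  interpret G: pair_graph ?G
    using pair_graph_direct_product pair_graphI_complete[OF K] H(1) by blast
  obtain g0 g1 where g: "pverts K = {g0, g1}" "g0 \<noteq> g1"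
    using K by (auto simp: complete_digraph_pair_def card_2_iff)
  let ?c = "\<lambda>x. if fst x = g0 then 0 else (1 :: nat)"
  have wf: "parcs ?G \<subseteq> pverts ?G \<times> pverts ?G" using G.wellformed' by auto
  \<comment> \<open>The first coordinate is a proper 2-colouring. The product is connected because
    \<open>H\<close> has walks of the parity that \<open>K\<close> prescribes.\<close>
  have strong: "strong_proper_vertex_coloring ?G ?c"
  proof (rule proper_coloring_strong[OF wf])
    fix u v assume uv: "u \<in> pverts ?G" "v \<in> pverts ?G"
    then obtain n where n: "even n = (fst u = fst v)" "(snd u, snd v) \<in> parcs H ^^ n"
      using nonbipartite_relpow_parity[OF H, of "snd u" "snd v" "fst u = fst v"]
      by (auto simp: direct_product_simps)
    have "\<exists>w\<in>pverts K. w \<noteq> fst u" using g by auto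
    then have "(fst u, fst v) \<in> parcs K ^^ n"
      using complete_relpow_parity[OF K] uv n(1) by (auto simp: direct_product_simps)
    then show "\<exists>n. (u, v) \<in> parcs ?G ^^ n"
      using n(2) direct_product_relpow[of "fst u" "snd u" "fst v" "snd v"] by auto
  next
    fix x y assume "(x, y) \<in> parcs ?G"
    then show "?c x \<noteq> ?c y"
      using g by (auto simp: direct_product_def complete_parcs_iff[OF K])
  qed
  obtain h where h: "h \<in> pverts H"
    using H(2) by (auto simp: Digraph_Component.connected_def strongly_connected_def mk_symmetric_def)
  \<comment> \<open>From \<open>(g0, h)\<close> to \<open>(g1, h)\<close>, lengths 0 and 2 fail in
    \<open>K\<close>, where even walks return to their start, and length 1 fails in
    \<open>H\<close>, which has no loops.\<close>
  have "2 \<le> spvc ?G"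
  proof (rule spvc_ge_two[OF G.pair_finite_verts strong])
    show "(g0, h) \<in> pverts ?G" "(g1, h) \<in> pverts ?G" using g h by (auto simp: direct_product_simps)
    show "((g0, h), (g1, h)) \<notin> parcs ?G ^^ m" if "m \<le> 2" for m
      using le_two_cases[OF that] g no_loops'[of h h]
      by (auto simp: direct_product_relpow direct_product_simps relpow_2_iff complete_parcs_iff[OF K])
  qed
  moreover have "spvc ?G \<le> 2" using strong card_two_valued_le by (rule spvc_le)
  ultimately show ?thesis by simp
qed

section \<open>Products with complete graphs of order at least three\<close>

lemma ex_neighbour:
  assumes H: "pair_graph H" "Digraph_Component.connected (with_proj H)" "2 \<le> card (pverts H)"
    and h: "h \<in> pverts H"
  shows "\<exists>w. (h, w) \<in> parcs H"
proof -
  interpret pair_graph H by fact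
  obtain h' where h': "h' \<in> pverts H" "h' \<noteq> h"
    using ex_avoiding[of "pverts H" "{h}"] H(3) pair_finite_verts by auto
  then obtain n where n: "(h, h') \<in> parcs H ^^ n" using connected_relpow[OF H(1,2) h] by blast
  with h' have "n \<noteq> 0" by (auto intro: gr0I)
  then obtain k where "n = Suc k" using not0_implies_Suc by blast
  then show ?thesis using n relpow_Suc_D2 by metis
qed

text \<open>Going to a neighbour of \<open>h\<close> and back first makes the walk in
  \<open>H\<close> at least two long, and then \<open>K\<close> has a matching walk.\<close>

lemma complete_product_relpow:
  assumes H: "pair_graph H" "Digraph_Component.connected (with_proj H)" "2 \<le> card (pverts H)"
    and K: "complete_digraph n (with_proj K)" "3 \<le> n"
    and uv: "u \<in> pverts K \<times> pverts H" "v \<in> pverts K \<times> pverts H"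
  shows "\<exists>L. (u, v) \<in> parcs (direct_product K H) ^^ L"
proof -
  interpret pair_graph H by fact
  obtain g h g' h' where eq: "u = (g, h)" "v = (g', h')" by (cases u, cases v)
  obtain w where "(h, w) \<in> parcs H" using ex_neighbour[OF H] uv eq by auto
  then have "(h, h) \<in> parcs H ^^ 2" using arcs_symmetric by (auto simp: relpow_2_iff)
  moreover obtain L where "(h, h') \<in> parcs H ^^ L" using connected_relpow[OF H(1,2)] uv eq by auto
  ultimately have "(h, h') \<in> parcs H ^^ (2 + L)" by (rule relpow_trans)
  moreover have "(g, g') \<in> parcs K ^^ (2 + L)"
    using uv eq by (intro complete_relpow[OF K]) auto
  ultimately have "(u, v) \<in> parcs (direct_product K H) ^^ (2 + L)"
    unfolding eq direct_product_relpow by blast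
  then show ?thesis by blast
qed

text \<open>Any two vertices of \<open>H\<close> are joined by a walk of length exactly two: through
  a neighbour if equal, through a triangle if adjacent, by the diameter otherwise. So the product
  has diameter at most two and one colour suffices.\<close>

lemma spvc_complete_product_triangles:
  assumes H: "pair_graph H" "Digraph_Component.connected (with_proj H)" "2 \<le> card (pverts H)"
    and diam: "diam H = 2" and tri: "every_edge_in_triangle H"
    and K: "complete_digraph n (with_proj K)" "3 \<le> n"
  shows "spvc (direct_product K H) = 1"
proof -
  interpret pair_graph H by fact
  let ?G = "direct_product K H"
  interpret G: pair_graph ?G
    using pair_graph_direct_product pair_graphI_complete[OF K(1)] H(1) by blast
  have wfG: "parcs ?G \<subseteq> pverts ?G \<times> pverts ?G" using G.wellformed' by auto
  have wfH: "parcs H \<subseteq> pverts H \<times> pverts H" using wellformed' by auto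
  have walk2: "(h, h') \<in> parcs H ^^ 2" if h: "h \<in> pverts H" "h' \<in> pverts H" for h h'
  proof -
    obtain m where "m \<le> 2" and m: "(h, h') \<in> parcs H ^^ m"
      using diam diam_le_iff[OF wfH, of 2] h by (auto simp: numeral_eq_enat)
    then consider "m = 0" | "m = 1" | "m = 2" using le_two_cases by blast
    then show ?thesis
    proof cases
      case 1
      then show ?thesis
        using m ex_neighbour[OF H h(1)] arcs_symmetric by (auto simp: relpow_2_iff)
    next
      case 2
      then have "(h, h') \<in> parcs H" using m by simp
      then obtain w where "(h, w) \<in> parcs H" "(h', w) \<in> parcs H"
        using tri by (auto simp: every_edge_in_triangle_def)
      then show ?thesis using arcs_symmetric by (auto simp: relpow_2_iff)
    next
      case 3
      then show ?thesis using m by simp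
    qed
  qed
  have "diam ?G \<le> enat 2"
    unfolding diam_le_iff[OF wfG]
  proof (intro ballI)
    fix u v assume "u \<in> pverts ?G" "v \<in> pverts ?G"
    then have "(u, v) \<in> parcs ?G ^^ 2"
      using walk2 complete_relpow[OF K order_refl]
      by (auto simp: direct_product_relpow direct_product_simps)
    then show "\<exists>m\<le>2. (u, v) \<in> parcs ?G ^^ m" by blast
  qed
  then have strong: "strong_proper_vertex_coloring ?G (\<lambda>_. 0)"
    by (intro diam_le_two_strong[OF wfG]) (simp add: numeral_eq_enat)
  obtain h h' where h: "h \<in> pverts H" "h' \<in> pverts H" "h \<noteq> h'"
    using H(3) pair_finite_verts by (metis card_le_Suc0_iff_eq not_less_eq_eq numeral_2_eq_2)
  obtain g where "g \<in> pverts K" using K by (fastforce simp: complete_digraph_pair_def)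
  \<comment> \<open>Vertices with the same first coordinate are never adjacent, so the product is
    not complete and the value 0 is excluded.\<close>
  then have "1 \<le> spvc ?G"
    using h by (intro spvc_pos[OF G.pair_finite_verts strong, of "(g, h)" "(g, h')"])
      (auto simp: direct_product_simps complete_parcs_iff[OF K(1)])
  moreover have "card ((\<lambda>_. 0 :: nat) ` pverts ?G) \<le> 1"
    using card_mono[of "{0 :: nat}" "(\<lambda>_. 0) ` pverts ?G"] by auto
  then have "spvc ?G \<le> 1" using strong by (intro spvc_le)
  ultimately show ?thesis by simp
qed

text \<open>A pair at distance at least three is found with a common first coordinate
  \<open>g\<close>: over an edge of \<open>H\<close> in no triangle if \<open>diam H = 2\<close>,
  and over two vertices of \<open>H\<close> at distance above two otherwise.\<close>

lemma spvc_complete_product_ge_two: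
  assumes H: "pair_graph H"
    and diam: "2 \<le> diam H" and neg: "\<not> (diam H = 2 \<and> every_edge_in_triangle H)"
    and K: "complete_digraph n (with_proj K)" "1 \<le> n"
    and strong: "strong_proper_vertex_coloring (direct_product K H) c"
  shows "2 \<le> spvc (direct_product K H)"
proof -
  interpret pair_graph H by fact
  let ?G = "direct_product K H"
  interpret G: pair_graph ?G
    using pair_graph_direct_product pair_graphI_complete[OF K(1)] H(1) by blast
  have wfH: "parcs H \<subseteq> pverts H \<times> pverts H" using wellformed' by auto
  obtain g where g: "g \<in> pverts K" using K by (fastforce simp: complete_digraph_pair_def)
  have "\<exists>h\<in>pverts H. \<exists>h'\<in>pverts H. \<forall>m\<le>2. ((g, h), (g, h')) \<notin> parcs ?G ^^ m"
  proof (cases "diam H = 2")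
    case True
    then obtain h h' where hh: "(h, h') \<in> parcs H"
      and no: "\<And>w. (h, w) \<in> parcs H \<Longrightarrow> (h', w) \<in> parcs H \<Longrightarrow> False"
      using neg by (auto simp: every_edge_in_triangle_def)
    \<comment> \<open>Length 2 would need a common neighbour of \<open>h\<close> and
      \<open>h'\<close>, length 1 a loop at \<open>g\<close>, and length 0 the equality
      \<open>h = h'\<close>.\<close>
    have "(h, h') \<notin> parcs H ^^ 2" using no arcs_symmetric unfolding relpow_2_iff by blast
    then have "((g, h), (g, h')) \<notin> parcs ?G ^^ m" if "m \<le> 2" for m
      using le_two_cases[OF that] no_loops'[OF hh]
      by (auto simp: direct_product_relpow complete_parcs_iff[OF K(1)] direct_product_simps)
    then show ?thesis using hh wellformed' by blast
  next
    case False
    then have "\<not> diam H \<le> enat 2" using diam by (auto simp: numeral_eq_enat)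
    then show ?thesis unfolding diam_le_iff[OF wfH] direct_product_relpow by blast
  qed
  then obtain h h' where "h \<in> pverts H" "h' \<in> pverts H"
    "\<forall>m\<le>2. ((g, h), (g, h')) \<notin> parcs ?G ^^ m" by blast
  then show ?thesis
    using g by (intro spvc_ge_two[OF G.pair_finite_verts strong, of "(g, h)" "(g, h')"])
      (auto simp: direct_product_simps)
qed

section \<open>Colourings for the upper bounds\<close>

lemma complete_product_two_coloring:
  assumes H: "pair_graph H" "Digraph_Component.connected (with_proj H)" "2 \<le> card (pverts H)"
    and K: "complete_digraph n (with_proj K)" "4 \<le> n"
  obtains c where "strong_proper_vertex_coloring (direct_product K H) c"
    "card (c ` pverts (direct_product K H)) \<le> 2"
proof -
  interpret pair_graph H by fact
  have K_card: "finite (pverts K)" "card (pverts K) = n"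
    using K(1) by (auto simp: complete_digraph_pair_def)
  then obtain xs where "set xs = pverts K" "distinct xs" "length xs = n"
    by (metis finite_distinct_list distinct_card)
  moreover then obtain a b p q ys where "xs = a # b # p # q # ys"
    using K(2) by (auto simp: numeral_eq_Suc Suc_le_length_iff)
  ultimately have abpq: "a \<in> pverts K" "b \<in> pverts K" "a \<noteq> b" "p \<in> pverts K" "q \<in> pverts K"
    "p \<noteq> q" "{a, b} \<inter> {p, q} = {}" by auto
  have "strong_proper_vertex_coloring (direct_product K H) (\<lambda>x. if fst x \<in> {a, b} then 0 else 1)"
  proof (rule alternating_strong_coloring[OF K(1) _ _ abpq])
    show "parcs H \<subseteq> pverts H \<times> pverts H" using wellformed' by auto
    show "\<exists>n. (u, v) \<in> parcs (direct_product K H) ^^ n"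
      if "u \<in> pverts K \<times> pverts H" "v \<in> pverts K \<times> pverts H" for u v
      using K(2) that by (intro complete_product_relpow[OF H K(1)]) auto
  qed
  then show thesis using card_two_valued_le by (rule that)
qed

text \<open>A bipartition of \<open>H\<close> pulls back along the second coordinate to a proper
  2-colouring of the product.\<close>

lemma complete_product_bipartite_coloring:
  assumes H: "pair_graph H" "Digraph_Component.connected (with_proj H)" "2 \<le> card (pverts H)"
    and "bipartite H" and K: "complete_digraph n (with_proj K)" "3 \<le> n"
  obtains c where "strong_proper_vertex_coloring (direct_product K H) c"
    "card (c ` pverts (direct_product K H)) \<le> 2"
proof -
  interpret pair_graph H by fact
  obtain U V where UV: "U \<inter> V = {}" "parcs H \<subseteq> U \<times> V \<union> V \<times> U"
    using \<open>bipartite H\<close> by (auto simp: bipartite_def)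
  have "strong_proper_vertex_coloring (direct_product K H) (\<lambda>x. if snd x \<in> U then 0 else 1)"
  proof (rule proper_coloring_strong)
    show "parcs (direct_product K H) \<subseteq> pverts (direct_product K H) \<times> pverts (direct_product K H)"
      using wellformed' by (auto simp: direct_product_def complete_parcs_iff[OF K(1)])
    show "\<exists>n. (u, v) \<in> parcs (direct_product K H) ^^ n"
      if "u \<in> pverts (direct_product K H)" "v \<in> pverts (direct_product K H)" for u v
      using that by (intro complete_product_relpow[OF H K]) (auto simp: direct_product_simps)
    show "(if snd x \<in> U then 0 else 1) \<noteq> (if snd y \<in> U then 0 else (1 :: nat))"
      if "(x, y) \<in> parcs (direct_product K H)" for x y
    proof -
      have "(snd x, snd y) \<in> parcs H" using that by (auto simp: direct_product_def)
      then have "(snd x, snd y) \<in> U \<times> V \<union> V \<times> U" using UV(2) by blast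
      then show ?thesis using UV(1) by auto
    qed
  qed
  then show thesis using card_two_valued_le by (rule that)
qed

lemma complete_product_fst_coloring:
  assumes H: "pair_graph H" "Digraph_Component.connected (with_proj H)" "2 \<le> card (pverts H)"
    and K: "complete_digraph n (with_proj K)" "3 \<le> n"
  obtains c where "strong_proper_vertex_coloring (direct_product K H) c"
    "card (c ` pverts (direct_product K H)) \<le> n"
proof -
  interpret pair_graph H by fact
  have K_card: "finite (pverts K)" "card (pverts K) = n"
    using K(1) by (auto simp: complete_digraph_pair_def)
  \<comment> \<open>Colours are natural numbers, so the vertices of \<open>K\<close> are numbered
    injectively; adjacent vertices of the product differ in the first coordinate.\<close>
  obtain e :: "_ \<Rightarrow> nat" where e: "inj_on e (pverts K)"
    using finite_imp_inj_to_nat_seg[OF K_card(1)] by blast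
  have strong: "strong_proper_vertex_coloring (direct_product K H) (\<lambda>x. e (fst x))"
  proof (rule proper_coloring_strong)
    show "parcs (direct_product K H) \<subseteq> pverts (direct_product K H) \<times> pverts (direct_product K H)"
      using wellformed' by (auto simp: direct_product_def complete_parcs_iff[OF K(1)])
    show "\<exists>n. (u, v) \<in> parcs (direct_product K H) ^^ n"
      if "u \<in> pverts (direct_product K H)" "v \<in> pverts (direct_product K H)" for u v
      using that by (intro complete_product_relpow[OF H K]) (auto simp: direct_product_simps)
    show "e (fst x) \<noteq> e (fst y)" if "(x, y) \<in> parcs (direct_product K H)" for x y
    proof -
      have "fst x \<in> pverts K" "fst y \<in> pverts K" "fst x \<noteq> fst y"
        using that by (auto simp: direct_product_def complete_parcs_iff[OF K(1)])
      then show ?thesis using inj_onD[OF e] by metis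
    qed
  qed
  have "card ((\<lambda>x. e (fst x)) ` pverts (direct_product K H)) \<le> card (e ` pverts K)"
    using K_card(1) by (intro card_mono) (auto simp: direct_product_simps)
  also have "\<dots> \<le> n" using card_image_le[OF K_card(1), of e] K_card(2) by simp
  finally show thesis using strong that by blast
qed

theorem theorem6p5:
  fixes H :: "'a pair_pre_digraph"
  assumes "pair_graph H"
    and "card (pverts H) \<ge> 2"
    and "Digraph_Component.connected (with_proj H)"
    and "diam H \<ge> 2"
  shows
    "(\<forall>K :: 'b pair_pre_digraph. complete_digraph 2 (with_proj K) \<longrightarrow>
        \<not> bipartite H \<longrightarrow> spvc (direct_product K H) = 2)
     \<and> (\<forall>n (K :: 'b pair_pre_digraph). n \<ge> 4 \<longrightarrow> complete_digraph n (with_proj K) \<longrightarrow>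
        (if diam H = 2 \<and> every_edge_in_triangle H
         then spvc (direct_product K H) = 1
         else spvc (direct_product K H) = 2))
     \<and> (\<forall>K :: 'b pair_pre_digraph. complete_digraph 3 (with_proj K) \<longrightarrow>
        (if diam H = 2 \<and> every_edge_in_triangle H
         then spvc (direct_product K H) = 1
         else if is_tree H
         then spvc (direct_product K H) = 2
         else 2 \<le> spvc (direct_product K H) \<and> spvc (direct_product K H) \<le> 3))"
proof (intro conjI allI impI)
  fix K :: "'b pair_pre_digraph"
  assume "complete_digraph 2 (with_proj K)" "\<not> bipartite H"
  then show "spvc (direct_product K H) = 2" using assms by (intro spvc_K2_product)
next
  fix n :: nat and K :: "'b pair_pre_digraph"
  assume n: "4 \<le> n" and K: "complete_digraph n (with_proj K)"
  \<comment> \<open>This colouring gives the upper bound and also the witness that the lower bound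
    needs for its \<open>LEAST\<close> to be attained.\<close>
  obtain c where c: "strong_proper_vertex_coloring (direct_product K H) c"
    "card (c ` pverts (direct_product K H)) \<le> 2"
    using complete_product_two_coloring[OF assms(1,3,2) K n] by blast
  show "if diam H = 2 \<and> every_edge_in_triangle H
         then spvc (direct_product K H) = 1
         else spvc (direct_product K H) = 2"
    using spvc_complete_product_triangles[OF assms(1,3,2) _ _ K]
      spvc_complete_product_ge_two[OF assms(1,4) _ K _ c(1)] spvc_le[OF c] n
    by auto
next
  fix K :: "'b pair_pre_digraph"
  assume K: "complete_digraph 3 (with_proj K)"
  obtain c where c: "strong_proper_vertex_coloring (direct_product K H) c"
    "card (c ` pverts (direct_product K H)) \<le> 3"
    using complete_product_fst_coloring[OF assms(1,3,2) K] by blast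
  \<comment> \<open>\<open>K\<^sub>3\<close> is too small for two disjoint classes of size two, so
    the two colours come from the bipartition of the tree.\<close>
  have "spvc (direct_product K H) \<le> 2" if "is_tree H"
    using complete_product_bipartite_coloring[OF assms(1,3,2) tree_bipartite[OF assms(1) that] K]
      spvc_le by blast
  then show "if diam H = 2 \<and> every_edge_in_triangle H
         then spvc (direct_product K H) = 1
         else if is_tree H
         then spvc (direct_product K H) = 2
         else 2 \<le> spvc (direct_product K H) \<and> spvc (direct_product K H) \<le> 3"
    using spvc_complete_product_triangles[OF assms(1,3,2) _ _ K]
      spvc_complete_product_ge_two[OF assms(1,4) _ K _ c(1)] spvc_le[OF c]
    by auto
qed

end
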